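(* Let $R$ be a $um$-ring, $M$ an $R$-module and $N$ a proper submodule of $M$. The following conditions are equivalent: (1) $N$ is a weakly classical prime submodule of $M$; (2) for every $a,b\in R$, $(N:_M ab)=(0:_M ab)$ or $(N:_M ab)=(N:_M a)$ or $(N:_M ab)=(N:_M b)$; (3) for every $a,b\in R$ and every submodule $L$ of $M$, $0\neq abL\subseteq N$ implies that $aL\subseteq N$ or $bL\subseteq N$; (4) for every $a\in R$ and every submodule $L$ of $M$ with $aL\nsubseteq N$, $(N:_R aL)=(0:_R aL)$ or $(N:_R aL)=(N:_R L)$; (5) for every $a\in R$, every ideal $I$ of $R$ and every submodule $L$ of $M$, $0\neq aIL\subseteq N$ implies that $aL\subseteq N$ or $IL\subseteq N$; (6) for every ideal $I$ of $R$ and every submodule $L$ of $M$ with $IL\nsubseteq N$, $(N:_R IL)=(0:_R IL)$ or $(N:_R IL)=(N:_R L)$; (7) for all ideals $I,J$ of $R$ and every submodule $L$ of $M$, $0\neq IJL\subseteq N$ implies that $IL\subseteq N$ or $JL\subseteq N$.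
   Context: All rings are commutative with nonzero identity and all modules are unitary. A $um$-ring is a ring $R$ such that any $R$-module which is equal to a finite union of submodules is equal to one of them. A proper submodule $N$ of $M$ is weakly classical prime if whenever $a,b\in R$ and $m\in M$ with $0\neq abm\in N$, then $am\in N$ or $bm\in N$. For $a\in R$ and a submodule $N$ of $M$, $(N:_M a)=\{m\in M\mid am\in N\}$; for a submodule $L$ of $M$, $(N:_R L)=\{r\in R\mid rL\subseteq N\}$. Here $0$ also denotes the zero submodule, and e.g. $0\neq IJL$ means that the submodule $IJL$ is not the zero submodule. *)

theory Defs
  imports "HOL-Algebra.Module" "HOL-Algebra.Ideal_Product"
begin

text \<open>
  In the definition of a um-ring, "any module" can only range over one carrier type in HOL.
  The type of lists over the ring's own element type suffices: if some module is a finite union of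
  submodules all different from it, choose an element outside each of them; the finitely generated
  submodule spanned by these elements has the same defect, and it injects into the lists of
  coefficients. Lemma \<open>um_ring_module\<close> below shows that the property then holds for modules over
  every carrier type.
\<close>

definition um_ring :: "('a, 'r) ring_scheme \<Rightarrow> bool" where
  "um_ring R \<longleftrightarrow> cring R \<and> \<one>\<^bsub>R\<^esub> \<noteq> \<zero>\<^bsub>R\<^esub> \<and>
     (\<forall>(M :: ('a, 'a list) module) \<N>.
        module R M \<and> finite \<N> \<and> (\<forall>N\<in>\<N>. submodule N R M) \<and> carrier M = \<Union>\<N>
          \<longrightarrow> carrier M \<in> \<N>)"

definition proper_submodule ::
  "'b set \<Rightarrow> ('a, 'r) ring_scheme \<Rightarrow> ('a, 'b, 'm) module_scheme \<Rightarrow> bool" where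
  "proper_submodule N R M \<longleftrightarrow> submodule N R M \<and> N \<noteq> carrier M"

definition weakly_classical_prime ::
  "'b set \<Rightarrow> ('a, 'r) ring_scheme \<Rightarrow> ('a, 'b, 'm) module_scheme \<Rightarrow> bool" where
  "weakly_classical_prime N R M \<longleftrightarrow> proper_submodule N R M \<and>
     (\<forall>a\<in>carrier R. \<forall>b\<in>carrier R. \<forall>m\<in>carrier M.
        (a \<otimes>\<^bsub>R\<^esub> b) \<odot>\<^bsub>M\<^esub> m \<noteq> \<zero>\<^bsub>M\<^esub> \<and> (a \<otimes>\<^bsub>R\<^esub> b) \<odot>\<^bsub>M\<^esub> m \<in> N
          \<longrightarrow> a \<odot>\<^bsub>M\<^esub> m \<in> N \<or> b \<odot>\<^bsub>M\<^esub> m \<in> N)"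

text \<open>\<open>elt_smult M a L\<close> is $aL$; it needs no closure under sums when \<open>L\<close> is a submodule.\<close>

definition elt_smult :: "('a, 'b, 'm) module_scheme \<Rightarrow> 'a \<Rightarrow> 'b set \<Rightarrow> 'b set" where
  "elt_smult M a L = (\<lambda>x. a \<odot>\<^bsub>M\<^esub> x) ` L"

text \<open>
  \<open>ideal_smult M I L\<close> is $IL$, the finite sums of products $ix$, in the style of
  \<open>ideal_prod\<close>. The empty sum is not lost, since ideals and submodules contain zero.
\<close>

inductive_set ideal_smult :: "('a, 'b, 'm) module_scheme \<Rightarrow> 'a set \<Rightarrow> 'b set \<Rightarrow> 'b set"
  for M and I and L where
    prod: "\<lbrakk>i \<in> I; x \<in> L\<rbrakk> \<Longrightarrow> i \<odot>\<^bsub>M\<^esub> x \<in> ideal_smult M I L"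
  | sum: "\<lbrakk>x \<in> ideal_smult M I L; y \<in> ideal_smult M I L\<rbrakk> \<Longrightarrow> x \<oplus>\<^bsub>M\<^esub> y \<in> ideal_smult M I L"

text \<open>\<open>mod_colon M N a\<close> is $(N :_M a)$, and \<open>ring_colon R M N L\<close> is $(N :_R L)$.\<close>

definition mod_colon :: "('a, 'b, 'm) module_scheme \<Rightarrow> 'b set \<Rightarrow> 'a \<Rightarrow> 'b set" where
  "mod_colon M N a = {m \<in> carrier M. a \<odot>\<^bsub>M\<^esub> m \<in> N}"

definition ring_colon ::
  "('a, 'r) ring_scheme \<Rightarrow> ('a, 'b, 'm) module_scheme \<Rightarrow> 'b set \<Rightarrow> 'b set \<Rightarrow> 'a set" where
  "ring_colon R M N L = {r \<in> carrier R. elt_smult M r L \<subseteq> N}"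

lemma (in module) submodule_zero: "submodule {\<zero>\<^bsub>M\<^esub>} R M"
  by (rule submoduleI) auto

lemma (in module) submodule_zero_closed: "submodule S R M \<Longrightarrow> \<zero>\<^bsub>M\<^esub> \<in> S"
  using subgroup.one_closed[OF submodule.axioms(1)] by fastforce

lemma (in module) finite_subset_small_submodule:
  assumes "finite A" "A \<subseteq> carrier M"
  shows "\<exists>S (g :: 'c \<Rightarrow> 'a list). submodule S R M \<and> A \<subseteq> S \<and> inj_on g S"
  using assms
proof (induction A rule: finite_induct)
  case empty
  have "inj_on (\<lambda>_. []) {\<zero>\<^bsub>M\<^esub>}" by simp
  then show ?case using submodule_zero by blast
next
  case (insert x A)
  then obtain S and g :: "'c \<Rightarrow> 'a list"
    where S: "submodule S R M" "A \<subseteq> S" "inj_on g S" by auto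
  have x: "x \<in> carrier M" using insert by simp
  note SE = submoduleE[OF S(1)]
  have Sc: "s \<in> carrier M" if "s \<in> S" for s using SE(1) that by auto
  define T where "T = {c \<odot>\<^bsub>M\<^esub> x \<oplus>\<^bsub>M\<^esub> s | c s. c \<in> carrier R \<and> s \<in> S}"
  have TI: "c \<odot>\<^bsub>M\<^esub> x \<oplus>\<^bsub>M\<^esub> s \<in> T" if "c \<in> carrier R" "s \<in> S" for c s
    using that T_def by blast
  have z: "\<zero>\<^bsub>M\<^esub> \<in> S" using submodule_zero_closed S(1) .
  have sub: "submodule T R M"
  proof (rule submoduleI)
    show "T \<subseteq> carrier M" using x Sc by (auto simp: T_def)
    show "\<zero>\<^bsub>M\<^esub> \<in> T" using TI[OF R.zero_closed z] x by simp
  next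
    fix a assume "a \<in> T"
    then obtain c s where a: "c \<in> carrier R" "s \<in> S" "a = c \<odot>\<^bsub>M\<^esub> x \<oplus>\<^bsub>M\<^esub> s" by (auto simp: T_def)
    then have "\<ominus>\<^bsub>M\<^esub> a = (\<ominus>\<^bsub>R\<^esub> c) \<odot>\<^bsub>M\<^esub> x \<oplus>\<^bsub>M\<^esub> (\<ominus>\<^bsub>M\<^esub> s)"
      using x Sc by (simp add: smult_l_minus M.minus_add)
    then show "\<ominus>\<^bsub>M\<^esub> a \<in> T" using TI a SE(3) by simp
  next
    fix a b assume "a \<in> T" "b \<in> T"
    then obtain c s d t where a: "c \<in> carrier R" "s \<in> S" "a = c \<odot>\<^bsub>M\<^esub> x \<oplus>\<^bsub>M\<^esub> s"
      and b: "d \<in> carrier R" "t \<in> S" "b = d \<odot>\<^bsub>M\<^esub> x \<oplus>\<^bsub>M\<^esub> t" by (auto simp: T_def)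
    then have "a \<oplus>\<^bsub>M\<^esub> b = (c \<oplus>\<^bsub>R\<^esub> d) \<odot>\<^bsub>M\<^esub> x \<oplus>\<^bsub>M\<^esub> (s \<oplus>\<^bsub>M\<^esub> t)"
      using x Sc by (simp add: smult_l_distr M.a_ac)
    then show "a \<oplus>\<^bsub>M\<^esub> b \<in> T" using TI a b SE(5) by simp
  next
    fix r a assume r: "r \<in> carrier R" and "a \<in> T"
    then obtain c s where a: "c \<in> carrier R" "s \<in> S" "a = c \<odot>\<^bsub>M\<^esub> x \<oplus>\<^bsub>M\<^esub> s" by (auto simp: T_def)
    then have "r \<odot>\<^bsub>M\<^esub> a = (r \<otimes>\<^bsub>R\<^esub> c) \<odot>\<^bsub>M\<^esub> x \<oplus>\<^bsub>M\<^esub> (r \<odot>\<^bsub>M\<^esub> s)"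
      using x Sc r by (simp add: smult_r_distr smult_assoc1)
    then show "r \<odot>\<^bsub>M\<^esub> a \<in> T" using TI a r SE(4) by simp
  qed
  have "x \<in> T" using TI[OF R.one_closed z] x by simp
  moreover have "A \<subseteq> T"
  proof
    fix a assume "a \<in> A"
    then have "a \<in> S" using S by auto
    then show "a \<in> T" using TI[OF R.zero_closed \<open>a \<in> S\<close>] x Sc by simp
  qed
  moreover have "\<exists>h :: 'c \<Rightarrow> 'a list. inj_on h T"
  proof -
    have "\<forall>y\<in>T. \<exists>p. fst p \<in> carrier R \<and> snd p \<in> S \<and> y = fst p \<odot>\<^bsub>M\<^esub> x \<oplus>\<^bsub>M\<^esub> snd p"
      by (auto simp: T_def)
    then obtain p where p: "\<And>y. y \<in> T \<Longrightarrow> fst (p y) \<in> carrier R \<and> snd (p y) \<in> S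
        \<and> y = fst (p y) \<odot>\<^bsub>M\<^esub> x \<oplus>\<^bsub>M\<^esub> snd (p y)" by metis
    have "inj_on (\<lambda>y. fst (p y) # g (snd (p y))) T"
    proof (rule inj_onI)
      fix y z assume y: "y \<in> T" and z: "z \<in> T"
        and e: "fst (p y) # g (snd (p y)) = fst (p z) # g (snd (p z))"
      then have "snd (p y) = snd (p z)" using p S(3) by (auto dest: inj_onD)
      with e p[OF y] p[OF z] show "y = z" by (metis list.inject)
    qed
    then show ?thesis by blast
  qed
  ultimately show ?case using sub by blast
qed

lemma um_ring_module:
  fixes R :: "('a, 'r) ring_scheme" and M :: "('a, 'b, 'm) module_scheme"
  assumes um: "um_ring R" and M: "module R M" and fin: "finite \<N>"
    and subs: "\<And>N. N \<in> \<N> \<Longrightarrow> submodule N R M" and cov: "carrier M = \<Union>\<N>"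
  shows "carrier M \<in> \<N>"
proof (rule ccontr)
  assume nin: "carrier M \<notin> \<N>"
  interpret M: module R M by (fact M)
  have "\<forall>N\<in>\<N>. \<exists>m. m \<in> carrier M - N"
  proof
    fix N assume N: "N \<in> \<N>"
    then have "N \<subseteq> carrier M" "N \<noteq> carrier M"
      using M.submoduleE(1)[OF subs[OF N]] nin by auto
    then show "\<exists>m. m \<in> carrier M - N" by blast
  qed
  then obtain w where w: "\<And>N. N \<in> \<N> \<Longrightarrow> w N \<in> carrier M - N" by metis
  have "finite (w ` \<N>)" "w ` \<N> \<subseteq> carrier M" using fin w by auto
  from M.finite_subset_small_submodule[OF this]
  obtain S and g :: "'b \<Rightarrow> 'a list"
    where S: "submodule S R M" and wS: "w ` \<N> \<subseteq> S" and g: "inj_on g S"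
    by (elim exE conjE)
  note SE = M.submoduleE[OF S]
  have Sc: "s \<in> carrier M" if "s \<in> S" for s using SE(1) that by auto
  have z: "\<zero>\<^bsub>M\<^esub> \<in> S" using M.submodule_zero_closed S .
  define f where "f = inv_into S g"
  have fg [simp]: "f (g s) = s" if "s \<in> S" for s using g that by (simp add: f_def)
  define M' :: "('a, 'a list) module" where
    "M' = \<lparr>carrier = g ` S, mult = undefined, one = undefined, zero = g \<zero>\<^bsub>M\<^esub>,
           add = (\<lambda>x y. g (f x \<oplus>\<^bsub>M\<^esub> f y)), smult = (\<lambda>c x. g (c \<odot>\<^bsub>M\<^esub> f x))\<rparr>"
  have M'_simps [simp]: "carrier M' = g ` S" "zero M' = g \<zero>\<^bsub>M\<^esub>"
    "add M' x y = g (f x \<oplus>\<^bsub>M\<^esub> f y)" "smult M' c x = g (c \<odot>\<^bsub>M\<^esub> f x)" for x y c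
    by (simp_all add: M'_def)
  have ab: "s \<oplus>\<^bsub>M\<^esub> t \<in> S" if "s \<in> S" "t \<in> S" for s t
    using SE(5) that by simp
  have "abelian_group M'"
  proof (rule abelian_groupI)
    fix x y assume "x \<in> carrier M'" "y \<in> carrier M'"
    then obtain s t where st: "s \<in> S" "x = g s" "t \<in> S" "y = g t" by auto
    show "x \<oplus>\<^bsub>M'\<^esub> y \<in> carrier M'" using st by (simp add: ab)
    show "x \<oplus>\<^bsub>M'\<^esub> y = y \<oplus>\<^bsub>M'\<^esub> x" using st by (simp add: Sc M.M.a_comm)
    fix u assume "u \<in> carrier M'"
    then obtain v where v: "v \<in> S" "u = g v" by auto
    show "x \<oplus>\<^bsub>M'\<^esub> y \<oplus>\<^bsub>M'\<^esub> u = x \<oplus>\<^bsub>M'\<^esub> (y \<oplus>\<^bsub>M'\<^esub> u)"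
      using st v by (simp add: ab Sc M.M.a_assoc)
  next
    show "\<zero>\<^bsub>M'\<^esub> \<in> carrier M'" using z by simp
  next
    fix x assume "x \<in> carrier M'"
    then obtain s where s: "s \<in> S" "x = g s" by auto
    show "\<zero>\<^bsub>M'\<^esub> \<oplus>\<^bsub>M'\<^esub> x = x" using s z by (simp add: Sc)
    show "\<exists>y\<in>carrier M'. y \<oplus>\<^bsub>M'\<^esub> x = \<zero>\<^bsub>M'\<^esub>"
    proof (rule bexI)
      show "g (\<ominus>\<^bsub>M\<^esub> s) \<oplus>\<^bsub>M'\<^esub> x = \<zero>\<^bsub>M'\<^esub>" using s SE(3)[OF s(1)] by (simp add: Sc M.M.l_neg)
      show "g (\<ominus>\<^bsub>M\<^esub> s) \<in> carrier M'" using SE(3)[OF s(1)] by simp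
    qed
  qed
  then have M': "module R M'"
  proof (intro moduleI)
    show "cring R" by (rule M.R.is_cring)
  next
    fix c x assume c: "c \<in> carrier R" and "x \<in> carrier M'"
    then obtain s where s: "s \<in> S" "x = g s" by auto
    show "c \<odot>\<^bsub>M'\<^esub> x \<in> carrier M'" using c s SE(4) by simp
  next
    fix x assume "x \<in> carrier M'"
    then obtain s where s: "s \<in> S" "x = g s" by auto
    show "\<one>\<^bsub>R\<^esub> \<odot>\<^bsub>M'\<^esub> x = x" using s Sc by simp
  next
    fix c d x assume c: "c \<in> carrier R" "d \<in> carrier R" and "x \<in> carrier M'"
    then obtain s where s: "s \<in> S" "x = g s" by auto
    show "(c \<oplus>\<^bsub>R\<^esub> d) \<odot>\<^bsub>M'\<^esub> x = c \<odot>\<^bsub>M'\<^esub> x \<oplus>\<^bsub>M'\<^esub> d \<odot>\<^bsub>M'\<^esub> x"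
      using c s SE(4) by (simp add: Sc M.smult_l_distr)
    show "(c \<otimes>\<^bsub>R\<^esub> d) \<odot>\<^bsub>M'\<^esub> x = c \<odot>\<^bsub>M'\<^esub> (d \<odot>\<^bsub>M'\<^esub> x)"
      using c s SE(4) by (simp add: Sc M.smult_assoc1)
  next
    fix c x y assume c: "c \<in> carrier R" and "x \<in> carrier M'" "y \<in> carrier M'"
    then obtain s t where s: "s \<in> S" "x = g s" "t \<in> S" "y = g t" by auto
    show "c \<odot>\<^bsub>M'\<^esub> (x \<oplus>\<^bsub>M'\<^esub> y) = c \<odot>\<^bsub>M'\<^esub> x \<oplus>\<^bsub>M'\<^esub> c \<odot>\<^bsub>M'\<^esub> y"
      using c s SE(4) by (simp add: ab Sc M.smult_r_distr)
  qed
  interpret M': module R M' by (fact M')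
  have neg: "\<ominus>\<^bsub>M'\<^esub> (g s) = g (\<ominus>\<^bsub>M\<^esub> s)" if s: "s \<in> S" for s
  proof (rule M'.M.minus_equality)
    show "g (\<ominus>\<^bsub>M\<^esub> s) \<oplus>\<^bsub>M'\<^esub> g s = \<zero>\<^bsub>M'\<^esub>" using s SE(3)[OF s] by (simp add: Sc M.M.l_neg)
  qed (use s SE(3)[OF s] in simp_all)
  define \<N>' where "\<N>' = (\<lambda>N. g ` (N \<inter> S)) ` \<N>"
  have "submodule N' R M'" if N': "N' \<in> \<N>'" for N'
  proof -
    obtain N where N: "N \<in> \<N>" "N' = g ` (N \<inter> S)" using N' by (auto simp: \<N>'_def)
    note NE = M.submoduleE[OF subs[OF N(1)]]
    show ?thesis unfolding N(2)
    proof (rule M'.submoduleI)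
      show "g ` (N \<inter> S) \<subseteq> carrier M'" by auto
      show "\<zero>\<^bsub>M'\<^esub> \<in> g ` (N \<inter> S)"
        using M.submodule_zero_closed[OF subs[OF N(1)]] z by simp
    next
      fix a assume "a \<in> g ` (N \<inter> S)"
      then obtain s where "s \<in> N" "s \<in> S" "a = g s" by auto
      then show "\<ominus>\<^bsub>M'\<^esub> a \<in> g ` (N \<inter> S)" using NE(3) SE(3) by (simp add: neg)
    next
      fix a b assume "a \<in> g ` (N \<inter> S)" "b \<in> g ` (N \<inter> S)"
      then obtain s t where "s \<in> N" "s \<in> S" "a = g s" "t \<in> N" "t \<in> S" "b = g t" by auto
      then show "a \<oplus>\<^bsub>M'\<^esub> b \<in> g ` (N \<inter> S)" using NE(5) SE(5) by simp
    next
      fix c x assume "c \<in> carrier R" "x \<in> g ` (N \<inter> S)"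
      then obtain s where "c \<in> carrier R" "s \<in> N" "s \<in> S" "x = g s" by auto
      then show "c \<odot>\<^bsub>M'\<^esub> x \<in> g ` (N \<inter> S)" using NE(4) SE(4) by simp
    qed
  qed
  moreover have "carrier M' = \<Union>\<N>'"
  proof -
    have "S \<subseteq> \<Union>\<N>" using cov SE(1) by simp
    then show ?thesis unfolding \<N>'_def M'_simps by blast
  qed
  moreover have "finite \<N>'" using fin by (simp add: \<N>'_def)
  ultimately have "carrier M' \<in> \<N>'" using um M' unfolding um_ring_def by blast
  then obtain N where N: "N \<in> \<N>" "g ` S = g ` (N \<inter> S)" by (auto simp: \<N>'_def)
  then have "S = N \<inter> S" using inj_on_image_eq_iff[OF g, of S "N \<inter> S"] by blast
  then show False using w[OF N(1)] wS N(1) by blast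
qed

end

theory Submission
  imports Defs
begin

text \<open>
  Each condition implies the next, and (7) implies (1). Under (1) the submodule $(N :_M ab)$ is
  the union of $(0 :_M ab)$, $(N :_M a)$ and $(N :_M b)$, hence equal to one of them over a
  um-ring, which gives (2). The steps to (4) and (6) use instead that an ideal which is the union
  of two ideals equals one of them. Everything else is the adjunction between products and
  colons: $IL \subseteq N$ if and only if $I \subseteq (N :_R L)$. Finally (7) is applied to
  principal ideals and a cyclic submodule to recover (1).
\<close>

section \<open>Finite unions of ideals and of submodules\<close>

text \<open>The usual argument for additive groups: with b in B outside C and c in C outside B, the
  sum b + c lies in A, yet subtracting b or c shows that it lies in neither B nor C.\<close>

lemma ideal_eq_Un_cases:
  assumes "ideal A R" "ideal B R" "ideal C R" and Un: "A = B \<union> C"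
  shows "A = B \<or> A = C"
proof (rule ccontr)
  interpret A: ideal A R by fact
  interpret B: ideal B R by fact
  interpret C: ideal C R by fact
  note A_closed = additive_subgroup.a_closed[OF A.additive_subgroup_axioms]
    and B_closed = additive_subgroup.a_closed[OF B.additive_subgroup_axioms]
    and C_closed = additive_subgroup.a_closed[OF C.additive_subgroup_axioms]
  assume "\<not> (A = B \<or> A = C)"
  then obtain b c where b: "b \<in> B" "b \<notin> C" and c: "c \<in> C" "c \<notin> B" using Un by blast
  have carr: "b \<in> carrier R" "c \<in> carrier R" using b(1) c(1) by (auto intro: B.Icarr C.Icarr)
  have "b \<in> A" "c \<in> A" using b c Un by auto
  then have "b \<oplus>\<^bsub>R\<^esub> c \<in> B \<union> C" unfolding Un[symmetric] by (rule A_closed)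
  then show False
  proof
    assume "b \<oplus>\<^bsub>R\<^esub> c \<in> B"
    then have "\<ominus>\<^bsub>R\<^esub> b \<oplus>\<^bsub>R\<^esub> (b \<oplus>\<^bsub>R\<^esub> c) \<in> B"
      by (rule B_closed[OF additive_subgroup.a_inv_closed[OF B.additive_subgroup_axioms b(1)]])
    moreover have "\<ominus>\<^bsub>R\<^esub> b \<oplus>\<^bsub>R\<^esub> (b \<oplus>\<^bsub>R\<^esub> c) = c" using carr by (rule A.r_neg1)
    ultimately show False using c by simp
  next
    assume "b \<oplus>\<^bsub>R\<^esub> c \<in> C"
    then have "(b \<oplus>\<^bsub>R\<^esub> c) \<oplus>\<^bsub>R\<^esub> \<ominus>\<^bsub>R\<^esub> c \<in> C"
      by (rule C_closed[OF _ additive_subgroup.a_inv_closed[OF C.additive_subgroup_axioms c(1)]])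
    moreover have "(b \<oplus>\<^bsub>R\<^esub> c) \<oplus>\<^bsub>R\<^esub> \<ominus>\<^bsub>R\<^esub> c = b"
      using carr by (simp add: A.a_assoc A.r_neg)
    ultimately show False using b by simp
  qed
qed

text \<open>\<open>um_ring_module\<close> covers the carrier of a whole module. Restricting the
  carrier of \<open>M\<close> to \<open>K\<close> makes \<open>K\<close> a module in its own right,
  so that the result reaches \<open>mod_colon M N (a \<otimes> b)\<close>.\<close>

lemma um_ring_submodule:
  assumes um: "um_ring R" and M: "module R M" and K: "submodule K R M" and fin: "finite \<N>"
    and subs: "\<And>N. N \<in> \<N> \<Longrightarrow> submodule N R M" and Un: "K = \<Union>\<N>"
  shows "K \<in> \<N>"
proof -
  interpret M: module R M by (fact M)
  have "module R (M\<lparr>carrier := K\<rparr>)" using submodule.submodule_is_module[OF K M] .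
  then interpret K: module R "M\<lparr>carrier := K\<rparr>" .
  have "submodule N R (M\<lparr>carrier := K\<rparr>)" if "N \<in> \<N>" for N
  proof (rule K.module_incl_imp_submodule)
    show "N \<subseteq> carrier (M\<lparr>carrier := K\<rparr>)" using that Un by auto
    show "module R (M\<lparr>carrier := K, carrier := N\<rparr>)"
      using submodule.submodule_is_module[OF subs[OF that] M] by simp
  qed
  from um_ring_module[OF um K.module_axioms fin this] Un show ?thesis by simp
qed

section \<open>Colon submodules and colon ideals\<close>

context module
begin

lemma mod_colon_submodule:
  assumes N: "submodule N R M" and a: "a \<in> carrier R"
  shows "submodule (mod_colon M N a) R M"
proof (rule submoduleI)
  show "\<zero>\<^bsub>M\<^esub> \<in> mod_colon M N a"
    using a submodule_zero_closed[OF N] by (simp add: mod_colon_def)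
next
  fix r x assume "r \<in> carrier R" "x \<in> mod_colon M N a"
  moreover from this have "a \<odot>\<^bsub>M\<^esub> (r \<odot>\<^bsub>M\<^esub> x) = r \<odot>\<^bsub>M\<^esub> (a \<odot>\<^bsub>M\<^esub> x)"
    using a by (simp add: mod_colon_def smult_assoc1[symmetric] R.m_comm)
  ultimately show "r \<odot>\<^bsub>M\<^esub> x \<in> mod_colon M N a"
    using submoduleE(4)[OF N] by (simp add: mod_colon_def)
qed (use a submoduleE[OF N] in \<open>auto simp: mod_colon_def smult_r_minus smult_r_distr\<close>)

lemma mod_colon_subset_mult:
  assumes N: "submodule N R M" and ab: "a \<in> carrier R" "b \<in> carrier R"
  shows "mod_colon M N b \<subseteq> mod_colon M N (a \<otimes> b)"
  using submoduleE(4)[OF N] ab by (auto simp: mod_colon_def smult_assoc1)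

lemma mod_colon_mono: "N \<subseteq> N' \<Longrightarrow> mod_colon M N a \<subseteq> mod_colon M N' a"
  by (auto simp: mod_colon_def)

text \<open>\<open>K\<close> may be any subset of the carrier, so the lemma applies to aL and IL
  without first proving them to be submodules.\<close>

lemma ring_colon_ideal:
  assumes N: "submodule N R M" and K: "K \<subseteq> carrier M"
  shows "ideal (ring_colon R M N K) R"
proof -
  note NE = submoduleE[OF N]
  have mem: "r \<in> ring_colon R M N K \<longleftrightarrow> r \<in> carrier R \<and> (\<forall>x\<in>K. r \<odot>\<^bsub>M\<^esub> x \<in> N)" for r
    by (auto simp: ring_colon_def elt_smult_def)
  have Kc: "x \<in> carrier M" if "x \<in> K" for x using K that by blast
  have l_closed: "x \<otimes> r \<in> ring_colon R M N K"
    if "r \<in> ring_colon R M N K" "x \<in> carrier R" for r x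
    using that NE(4) by (auto simp: mem Kc smult_assoc1)
  have "additive_subgroup (ring_colon R M N K) R"
    unfolding additive_subgroup_def
  proof (rule R.add.subgroupI)
    show "ring_colon R M N K \<subseteq> carrier R" by (auto simp: mem)
    have "\<zero> \<in> ring_colon R M N K"
      using submodule_zero_closed[OF N] by (simp add: mem Kc)
    then show "ring_colon R M N K \<noteq> {}" by blast
  next
    fix r assume "r \<in> ring_colon R M N K"
    then show "\<ominus> r \<in> ring_colon R M N K"
      using NE(3) by (auto simp: mem Kc smult_l_minus)
  next
    fix r s assume "r \<in> ring_colon R M N K" "s \<in> ring_colon R M N K"
    then show "r \<oplus> s \<in> ring_colon R M N K"
      using NE(5) by (auto simp: mem Kc smult_l_distr)
  qed
  then show ?thesis
    using l_closed
    by (intro idealI R.ring_axioms) (auto simp: additive_subgroup_def mem R.m_comm)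
qed

lemma ring_colon_mono: "N \<subseteq> N' \<Longrightarrow> K' \<subseteq> K \<Longrightarrow> ring_colon R M N K \<subseteq> ring_colon R M N' K'"
  by (fastforce simp: ring_colon_def elt_smult_def)

section \<open>Adjunctions between products and colons\<close>

lemma elt_smult_elt_smult:
  assumes "r \<in> carrier R" "a \<in> carrier R" "L \<subseteq> carrier M"
  shows "elt_smult M r (elt_smult M a L) = elt_smult M (r \<otimes> a) L"
  unfolding elt_smult_def image_image using assms
  by (intro image_cong) (auto simp: smult_assoc1)

lemma elt_smult_subset_iff:
  assumes "L \<subseteq> carrier M"
  shows "elt_smult M a L \<subseteq> N \<longleftrightarrow> L \<subseteq> mod_colon M N a"
  using assms by (auto simp: elt_smult_def mod_colon_def)

lemma elt_smult_subset:
  assumes "submodule L R M" "a \<in> carrier R"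
  shows "elt_smult M a L \<subseteq> L"
  using submoduleE(4)[OF assms(1)] assms(2) by (auto simp: elt_smult_def)

text \<open>By commutativity (ab)L = b(aL), so the factor a can be moved from the ring element into
  the set.\<close>

lemma mult_mem_ring_colon_iff:
  assumes "a \<in> carrier R" "b \<in> carrier R" "L \<subseteq> carrier M"
  shows "a \<otimes> b \<in> ring_colon R M N L \<longleftrightarrow> b \<in> ring_colon R M N (elt_smult M a L)"
  using assms unfolding R.m_comm[OF assms(1,2)] by (simp add: ring_colon_def elt_smult_elt_smult)

text \<open>Since \<open>N\<close> is closed under sums, containment of IL need only be tested on
  the products ix, and these lie in \<open>N\<close> exactly when each i carries \<open>L\<close>
  into \<open>N\<close>.\<close>

lemma ideal_smult_subset_iff:
  assumes N: "submodule N R M" and I: "I \<subseteq> carrier R"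
  shows "ideal_smult M I L \<subseteq> N \<longleftrightarrow> I \<subseteq> ring_colon R M N L"
proof
  assume "ideal_smult M I L \<subseteq> N"
  then show "I \<subseteq> ring_colon R M N L"
    using I by (auto simp: ring_colon_def elt_smult_def intro: ideal_smult.prod)
next
  assume *: "I \<subseteq> ring_colon R M N L"
  show "ideal_smult M I L \<subseteq> N"
  proof
    fix y assume "y \<in> ideal_smult M I L"
    then show "y \<in> N"
    proof induction
      case (prod i x)
      then show ?case using * by (auto simp: ring_colon_def elt_smult_def)
    next
      case (sum x y)
      then show ?case using submoduleE(5)[OF N] by blast
    qed
  qed
qed

lemma ideal_smult_subset:
  assumes L: "submodule L R M" and I: "I \<subseteq> carrier R"
  shows "ideal_smult M I L \<subseteq> L"
  \<comment> \<open>The adjunction with \<open>L\<close> itself as target: every scalar carries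
    \<open>L\<close> into \<open>L\<close>.\<close>
  unfolding ideal_smult_subset_iff[OF assms]
  using I elt_smult_subset[OF L] by (auto simp: ring_colon_def)

text \<open>Apply the adjunction twice: first move a to the right, giving IL inside (N :_M a), then
  move I. The resulting ideal ((N :_M a) :_R L) is (N :_R aL) because scalars commute.\<close>

lemma elt_smult_ideal_smult_subset_iff:
  assumes N: "submodule N R M" and L: "submodule L R M" and I: "I \<subseteq> carrier R"
    and a: "a \<in> carrier R"
  shows "elt_smult M a (ideal_smult M I L) \<subseteq> N \<longleftrightarrow> I \<subseteq> ring_colon R M N (elt_smult M a L)"
proof -
  have Lc: "L \<subseteq> carrier M" using submoduleE(1)[OF L] .
  have "elt_smult M a (ideal_smult M I L) \<subseteq> N \<longleftrightarrow> ideal_smult M I L \<subseteq> mod_colon M N a"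
    using ideal_smult_subset[OF L I] Lc by (intro elt_smult_subset_iff) blast
  also have "\<dots> \<longleftrightarrow> I \<subseteq> ring_colon R M (mod_colon M N a) L"
    using ideal_smult_subset_iff[OF mod_colon_submodule[OF N a] I] .
  \<comment> \<open>This equivalence for a single r is auxiliary: it yields the equality of colon
    ideals stated next, which is the last link of the chain.\<close>
  also have "elt_smult M r L \<subseteq> mod_colon M N a \<longleftrightarrow> elt_smult M r (elt_smult M a L) \<subseteq> N"
    if r: "r \<in> carrier R" for r
    using elt_smult_subset_iff[of "elt_smult M r L" a N] elt_smult_subset[OF L r] Lc a r
      elt_smult_elt_smult[OF a r Lc] elt_smult_elt_smult[OF r a Lc] R.m_comm[OF a r] by auto
  then have "ring_colon R M (mod_colon M N a) L = ring_colon R M N (elt_smult M a L)"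
    by (auto simp: ring_colon_def)
  finally show ?thesis .
qed

text \<open>This plays the part of (IJ)L = I(JL), since the right side says that I(JL) lies in
  \<open>N\<close>. Both sides reduce to the products ij: for fixed i, the condition on all j says
  that \<open>J\<close> lies in (N :_R iL), that is, i(JL) lies in \<open>N\<close>.\<close>

lemma ideal_prod_smult_subset_iff:
  assumes N: "submodule N R M" and L: "submodule L R M" and I: "ideal I R" and J: "ideal J R"
  shows "ideal_smult M (I \<cdot> J) L \<subseteq> N \<longleftrightarrow> I \<subseteq> ring_colon R M N (ideal_smult M J L)"
proof -
  have Ic: "I \<subseteq> carrier R" and Jc: "J \<subseteq> carrier R"
    using ideal.Icarr[OF I] ideal.Icarr[OF J] by auto
  have Lc: "L \<subseteq> carrier M" using submoduleE(1)[OF L] .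
  have C: "additive_subgroup (ring_colon R M N L) R"
    using ideal.axioms(1)[OF ring_colon_ideal[OF N Lc]] .
  have "I \<cdot> J \<subseteq> ring_colon R M N L \<longleftrightarrow> (\<forall>i\<in>I. \<forall>j\<in>J. i \<otimes> j \<in> ring_colon R M N L)"
    (is "?l \<longleftrightarrow> ?r")
  proof
    assume ?l then show ?r by (blast intro: ideal_prod.prod)
  next
    assume r: ?r
    show ?l
    proof
      fix s assume "s \<in> I \<cdot> J"
      then show "s \<in> ring_colon R M N L" by induction (use r additive_subgroup.a_closed[OF C] in auto)
    qed
  qed
  also have "\<dots> \<longleftrightarrow> (\<forall>i\<in>I. J \<subseteq> ring_colon R M N (elt_smult M i L))"
    using mult_mem_ring_colon_iff[OF _ _ Lc] Ic Jc by blast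
  also have "\<dots> \<longleftrightarrow> (\<forall>i\<in>I. elt_smult M i (ideal_smult M J L) \<subseteq> N)"
    using elt_smult_ideal_smult_subset_iff[OF N L Jc] Ic by blast
  also have "\<dots> \<longleftrightarrow> I \<subseteq> ring_colon R M N (ideal_smult M J L)"
    using Ic by (auto simp: ring_colon_def)
  finally show ?thesis
    using ideal_smult_subset_iff[OF N R.ideal_prod_in_carrier[OF I J]] by simp
qed

section \<open>Principal ideals and cyclic submodules\<close>

text \<open>The colon (N :_R L) is an ideal, so it contains the principal ideal of a as soon as it
  contains a.\<close>

lemma cgenideal_smult_subset_iff:
  assumes N: "submodule N R M" and L: "submodule L R M" and a: "a \<in> carrier R"
  shows "ideal_smult M (PIdl a) L \<subseteq> N \<longleftrightarrow> elt_smult M a L \<subseteq> N"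
proof -
  have "PIdl a \<subseteq> carrier R" using ideal.Icarr[OF R.cgenideal_ideal[OF a]] by auto
  then have "ideal_smult M (PIdl a) L \<subseteq> N \<longleftrightarrow> PIdl a \<subseteq> ring_colon R M N L"
    by (rule ideal_smult_subset_iff[OF N])
  also have "\<dots> \<longleftrightarrow> a \<in> ring_colon R M N L"
    using R.cgenideal_minimal[OF ring_colon_ideal[OF N submoduleE(1)[OF L]]]
      R.cgenideal_self[OF a] by blast
  finally show ?thesis using a by (simp add: ring_colon_def)
qed

lemma cyclic_submodule:
  assumes m: "m \<in> carrier M"
  shows "submodule ((\<lambda>c. c \<odot>\<^bsub>M\<^esub> m) ` carrier R) R M"
proof (rule submoduleI)
  show "\<zero>\<^bsub>M\<^esub> \<in> (\<lambda>c. c \<odot>\<^bsub>M\<^esub> m) ` carrier R"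
    using m by (auto intro!: image_eqI[of _ _ \<zero>])
qed (use m in \<open>auto simp: smult_l_minus[symmetric] smult_l_distr[symmetric] smult_assoc1[symmetric]\<close>)

lemma elt_smult_cyclic_subset_iff:
  assumes N: "submodule N R M" and a: "a \<in> carrier R" and m: "m \<in> carrier M"
  shows "elt_smult M a ((\<lambda>c. c \<odot>\<^bsub>M\<^esub> m) ` carrier R) \<subseteq> N \<longleftrightarrow> a \<odot>\<^bsub>M\<^esub> m \<in> N"
proof
  assume "elt_smult M a ((\<lambda>c. c \<odot>\<^bsub>M\<^esub> m) ` carrier R) \<subseteq> N"
  then have "a \<odot>\<^bsub>M\<^esub> (\<one> \<odot>\<^bsub>M\<^esub> m) \<in> N" by (auto simp: elt_smult_def)
  then show "a \<odot>\<^bsub>M\<^esub> m \<in> N" using m by simp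
next
  assume *: "a \<odot>\<^bsub>M\<^esub> m \<in> N"
  have "a \<odot>\<^bsub>M\<^esub> (c \<odot>\<^bsub>M\<^esub> m) = c \<odot>\<^bsub>M\<^esub> (a \<odot>\<^bsub>M\<^esub> m)" if "c \<in> carrier R" for c
    using that a m by (simp add: smult_assoc1[symmetric] R.m_comm)
  then show "elt_smult M a ((\<lambda>c. c \<odot>\<^bsub>M\<^esub> m) ` carrier R) \<subseteq> N"
    using submoduleE(4)[OF N] * by (auto simp: elt_smult_def)
qed

text \<open>The two principal ideals and the cyclic submodule are replaced by their generators one
  at a time, with a moved into the colon (N :_M a) while b and m are treated. Taking the zero
  submodule for \<open>N\<close> gives the matching criterion for vanishing.\<close>

lemma cgenideal_prod_smult_cyclic_subset_iff:
  assumes N: "submodule N R M" and a: "a \<in> carrier R" and b: "b \<in> carrier R"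
    and m: "m \<in> carrier M"
  shows "ideal_smult M ((PIdl a) \<cdot> (PIdl b)) ((\<lambda>c. c \<odot>\<^bsub>M\<^esub> m) ` carrier R) \<subseteq> N
    \<longleftrightarrow> (a \<otimes> b) \<odot>\<^bsub>M\<^esub> m \<in> N"
proof -
  define L where "L = (\<lambda>c. c \<odot>\<^bsub>M\<^esub> m) ` carrier R"
  have L: "submodule L R M" unfolding L_def using cyclic_submodule[OF m] .
  have I: "ideal (PIdl a) R" and J: "ideal (PIdl b) R" using R.cgenideal_ideal a b by auto
  have Jc: "PIdl b \<subseteq> carrier R" using ideal.Icarr[OF J] by auto
  define K where "K = ideal_smult M (PIdl b) L"
  have Kc: "K \<subseteq> carrier M"
    using ideal_smult_subset[OF L Jc] submoduleE(1)[OF L] by (auto simp: K_def)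
  have "ideal_smult M ((PIdl a) \<cdot> (PIdl b)) L \<subseteq> N \<longleftrightarrow> PIdl a \<subseteq> ring_colon R M N K"
    unfolding K_def using ideal_prod_smult_subset_iff[OF N L I J] .
  also have "\<dots> \<longleftrightarrow> a \<in> ring_colon R M N K"
    using R.cgenideal_minimal[OF ring_colon_ideal[OF N Kc]] R.cgenideal_self[OF a] by blast
  also have "\<dots> \<longleftrightarrow> K \<subseteq> mod_colon M N a"
    using a elt_smult_subset_iff[OF Kc] by (simp add: ring_colon_def)
  also have "\<dots> \<longleftrightarrow> elt_smult M b L \<subseteq> mod_colon M N a"
    unfolding K_def using cgenideal_smult_subset_iff[OF mod_colon_submodule[OF N a] L b] .
  also have "\<dots> \<longleftrightarrow> b \<odot>\<^bsub>M\<^esub> m \<in> mod_colon M N a"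
    unfolding L_def using elt_smult_cyclic_subset_iff[OF mod_colon_submodule[OF N a] b m] .
  also have "\<dots> \<longleftrightarrow> (a \<otimes> b) \<odot>\<^bsub>M\<^esub> m \<in> N"
    using a b m by (simp add: mod_colon_def smult_assoc1)
  finally show ?thesis unfolding L_def .
qed

section \<open>The dichotomy for colon ideals\<close>

text \<open>The common core of (3) to (4), with K = aL, and of (5) to (6), with K = IL. The
  hypothesis \<open>cases\<close> puts (N :_R K) inside the union of (0 :_R K) and (N :_R L); the
  reverse inclusion comes from monotonicity, using that \<open>K\<close> lies in \<open>L\<close>.
  Then \<open>ideal_eq_Un_cases\<close> applies.\<close>

lemma ring_colon_cases:
  assumes N: "submodule N R M" and L: "L \<subseteq> carrier M" and K: "K \<subseteq> L"
    and cases: "\<And>r. r \<in> carrier R \<Longrightarrow> elt_smult M r K \<subseteq> N \<Longrightarrow>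
      elt_smult M r K \<subseteq> {\<zero>\<^bsub>M\<^esub>} \<or> elt_smult M r L \<subseteq> N"
  shows "ring_colon R M N K = ring_colon R M {\<zero>\<^bsub>M\<^esub>} K \<or> ring_colon R M N K = ring_colon R M N L"
proof (rule ideal_eq_Un_cases)
  have Kc: "K \<subseteq> carrier M" using K L by blast
  show "ideal (ring_colon R M N K) R" using ring_colon_ideal[OF N Kc] .
  show "ideal (ring_colon R M {\<zero>\<^bsub>M\<^esub>} K) R" using ring_colon_ideal[OF submodule_zero Kc] .
  show "ideal (ring_colon R M N L) R" using ring_colon_ideal[OF N L] .
  have "ring_colon R M {\<zero>\<^bsub>M\<^esub>} K \<subseteq> ring_colon R M N K"
    using submodule_zero_closed[OF N] by (intro ring_colon_mono) auto
  moreover have "ring_colon R M N L \<subseteq> ring_colon R M N K"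
    using K by (intro ring_colon_mono) auto
  moreover have "ring_colon R M N K \<subseteq> ring_colon R M {\<zero>\<^bsub>M\<^esub>} K \<union> ring_colon R M N L"
    using cases by (auto simp: ring_colon_def)
  ultimately show "ring_colon R M N K = ring_colon R M {\<zero>\<^bsub>M\<^esub>} K \<union> ring_colon R M N L" by blast
qed

end

lemma ideal_smult_nonempty: "I \<noteq> {} \<Longrightarrow> L \<noteq> {} \<Longrightarrow> ideal_smult M I L \<noteq> {}"
  by (auto intro: ideal_smult.prod)

lemma ideal_prod_nonempty: "I \<noteq> {} \<Longrightarrow> J \<noteq> {} \<Longrightarrow> ideal_prod R I J \<noteq> {}"
  by (auto intro: ideal_prod.prod)

section \<open>The cycle of implications\<close>

theorem theorem2p25:
  fixes R :: "('a, 'r) ring_scheme" and M :: "('a, 'b, 'm) module_scheme" and N :: "'b set"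
  assumes "um_ring R" and "module R M" and "proper_submodule N R M"
  shows
    "(weakly_classical_prime N R M \<longleftrightarrow>
        (\<forall>a\<in>carrier R. \<forall>b\<in>carrier R.
           mod_colon M N (a \<otimes>\<^bsub>R\<^esub> b) = mod_colon M {\<zero>\<^bsub>M\<^esub>} (a \<otimes>\<^bsub>R\<^esub> b) \<or>
           mod_colon M N (a \<otimes>\<^bsub>R\<^esub> b) = mod_colon M N a \<or>
           mod_colon M N (a \<otimes>\<^bsub>R\<^esub> b) = mod_colon M N b)) \<and>
     (weakly_classical_prime N R M \<longleftrightarrow>
        (\<forall>a\<in>carrier R. \<forall>b\<in>carrier R. \<forall>L. submodule L R M \<longrightarrow>
           elt_smult M (a \<otimes>\<^bsub>R\<^esub> b) L \<noteq> {\<zero>\<^bsub>M\<^esub>} \<and> elt_smult M (a \<otimes>\<^bsub>R\<^esub> b) L \<subseteq> N \<longrightarrow>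
           elt_smult M a L \<subseteq> N \<or> elt_smult M b L \<subseteq> N)) \<and>
     (weakly_classical_prime N R M \<longleftrightarrow>
        (\<forall>a\<in>carrier R. \<forall>L. submodule L R M \<and> \<not> elt_smult M a L \<subseteq> N \<longrightarrow>
           ring_colon R M N (elt_smult M a L) = ring_colon R M {\<zero>\<^bsub>M\<^esub>} (elt_smult M a L) \<or>
           ring_colon R M N (elt_smult M a L) = ring_colon R M N L)) \<and>
     (weakly_classical_prime N R M \<longleftrightarrow>
        (\<forall>a\<in>carrier R. \<forall>I L. ideal I R \<and> submodule L R M \<longrightarrow>
           elt_smult M a (ideal_smult M I L) \<noteq> {\<zero>\<^bsub>M\<^esub>} \<and>
           elt_smult M a (ideal_smult M I L) \<subseteq> N \<longrightarrow>
           elt_smult M a L \<subseteq> N \<or> ideal_smult M I L \<subseteq> N)) \<and>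
     (weakly_classical_prime N R M \<longleftrightarrow>
        (\<forall>I L. ideal I R \<and> submodule L R M \<and> \<not> ideal_smult M I L \<subseteq> N \<longrightarrow>
           ring_colon R M N (ideal_smult M I L) = ring_colon R M {\<zero>\<^bsub>M\<^esub>} (ideal_smult M I L) \<or>
           ring_colon R M N (ideal_smult M I L) = ring_colon R M N L)) \<and>
     (weakly_classical_prime N R M \<longleftrightarrow>
        (\<forall>I J L. ideal I R \<and> ideal J R \<and> submodule L R M \<longrightarrow>
           ideal_smult M (ideal_prod R I J) L \<noteq> {\<zero>\<^bsub>M\<^esub>} \<and>
           ideal_smult M (ideal_prod R I J) L \<subseteq> N \<longrightarrow>
           ideal_smult M I L \<subseteq> N \<or> ideal_smult M J L \<subseteq> N))"
  (is "(?c1 \<longleftrightarrow> ?c2) \<and> (?c1 \<longleftrightarrow> ?c3) \<and> (?c1 \<longleftrightarrow> ?c4) \<and> (?c1 \<longleftrightarrow> ?c5) \<and> (?c1 \<longleftrightarrow> ?c6) \<and> (?c1 \<longleftrightarrow> ?c7)")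
proof -
  interpret M: module R M by fact
  have N: "submodule N R M" using assms(3) by (simp add: proper_submodule_def)
  have N0: "\<zero>\<^bsub>M\<^esub> \<in> N" using M.submodule_zero_closed[OF N] .
  note Z = M.submodule_zero
  note subc = M.submoduleE(1)
  have idc: "I \<subseteq> carrier R" if "ideal I R" for I using ideal.Icarr[OF that] by auto
  have idne: "I \<noteq> {}" if "ideal I R" for I
    using additive_subgroup.zero_closed[OF ideal.axioms(1)[OF that]] by auto
  \<comment> \<open>Nonvanishing is stated as being different from the zero set, while the
    adjunctions decide containment in it. For nonempty sets the two agree, hence the nonemptiness
    facts.\<close>
  have nz: "S \<noteq> {\<zero>\<^bsub>M\<^esub>} \<longleftrightarrow> \<not> S \<subseteq> {\<zero>\<^bsub>M\<^esub>}" if "S \<noteq> {}" for S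
    using that by auto
  have nz_elt: "elt_smult M a L \<noteq> {}" if "L \<noteq> {}" for a L
    using that by (simp add: elt_smult_def)

  have c12: ?c2 if ?c1
  proof (intro ballI)
    fix a b assume a: "a \<in> carrier R" and b: "b \<in> carrier R"
    let ?K = "mod_colon M N (a \<otimes>\<^bsub>R\<^esub> b)"
    let ?\<N> = "{mod_colon M {\<zero>\<^bsub>M\<^esub>} (a \<otimes>\<^bsub>R\<^esub> b), mod_colon M N a, mod_colon M N b}"
    have "?K \<subseteq> \<Union>?\<N>"
      using \<open>?c1\<close> a b by (auto simp: weakly_classical_prime_def mod_colon_def)
    \<comment> \<open>One lemma gives both inclusions: (N :_M a) lies in (N :_M ba), and
      commutativity turns ba into ab.\<close>
    moreover have "mod_colon M N a \<subseteq> ?K" "mod_colon M N b \<subseteq> ?K"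
      using M.mod_colon_subset_mult[OF N b a] M.mod_colon_subset_mult[OF N a b]
      by (simp_all add: M.R.m_comm a b)
    moreover have "mod_colon M {\<zero>\<^bsub>M\<^esub>} (a \<otimes>\<^bsub>R\<^esub> b) \<subseteq> ?K"
      using N0 by (intro M.mod_colon_mono) simp
    ultimately have "?K = \<Union>?\<N>" by blast
    moreover have "submodule S R M" if "S \<in> ?\<N>" for S
      using that M.mod_colon_submodule[OF N] M.mod_colon_submodule[OF Z] a b by auto
    moreover have "submodule ?K R M" using M.mod_colon_submodule[OF N] a b by simp
    \<comment> \<open>The um-ring hypothesis enters here: with three submodules, the argument used
      for a union of two ideals does not suffice.\<close>
    ultimately have "?K \<in> ?\<N>"
      by (intro um_ring_submodule[OF assms(1,2)]) simp_all
    then show "?K = mod_colon M {\<zero>\<^bsub>M\<^esub>} (a \<otimes>\<^bsub>R\<^esub> b) \<or> ?K = mod_colon M N a \<or> ?K = mod_colon M N b"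
      by simp
  qed

  have c23: ?c3 if ?c2
  proof (intro ballI allI impI)
    fix a b L assume a: "a \<in> carrier R" and b: "b \<in> carrier R" and L: "submodule L R M"
      and *: "elt_smult M (a \<otimes>\<^bsub>R\<^esub> b) L \<noteq> {\<zero>\<^bsub>M\<^esub>} \<and> elt_smult M (a \<otimes>\<^bsub>R\<^esub> b) L \<subseteq> N"
    have "L \<subseteq> mod_colon M N (a \<otimes>\<^bsub>R\<^esub> b)" "\<not> L \<subseteq> mod_colon M {\<zero>\<^bsub>M\<^esub>} (a \<otimes>\<^bsub>R\<^esub> b)"
      using * nz[OF nz_elt[OF M.submoduleE(2)[OF L]]] M.elt_smult_subset_iff[OF subc[OF L]] by auto
    \<comment> \<open>\<open>L\<close> is not inside (0 :_M ab), which excludes the first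
      alternative of (2).\<close>
    then have "L \<subseteq> mod_colon M N a \<or> L \<subseteq> mod_colon M N b" using \<open>?c2\<close> a b by metis
    then show "elt_smult M a L \<subseteq> N \<or> elt_smult M b L \<subseteq> N"
      using M.elt_smult_subset_iff[OF subc[OF L]] by simp
  qed

  have c34: ?c4 if ?c3
  proof (intro ballI allI impI)
    fix a L assume a: "a \<in> carrier R" and *: "submodule L R M \<and> \<not> elt_smult M a L \<subseteq> N"
    then have L: "submodule L R M" by simp
    show "ring_colon R M N (elt_smult M a L) = ring_colon R M {\<zero>\<^bsub>M\<^esub>} (elt_smult M a L) \<or>
      ring_colon R M N (elt_smult M a L) = ring_colon R M N L"
    proof (rule M.ring_colon_cases[OF N subc[OF L] M.elt_smult_subset[OF L a]])
      fix r assume r: "r \<in> carrier R" "elt_smult M r (elt_smult M a L) \<subseteq> N"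
      \<comment> \<open>Condition (3) is used for the pair r, a: if (ra)L is nonzero, then rL or aL
        lies in \<open>N\<close>, and the latter is excluded by assumption.\<close>
      then show "elt_smult M r (elt_smult M a L) \<subseteq> {\<zero>\<^bsub>M\<^esub>} \<or> elt_smult M r L \<subseteq> N"
        using \<open>?c3\<close>[rule_format, OF r(1) a L] * M.elt_smult_elt_smult[OF r(1) a subc[OF L]] by auto
    qed
  qed

  have c45: ?c5 if ?c4
  proof (intro ballI allI impI)
    fix a I L assume a: "a \<in> carrier R" and "ideal I R \<and> submodule L R M"
      and *: "elt_smult M a (ideal_smult M I L) \<noteq> {\<zero>\<^bsub>M\<^esub>} \<and> elt_smult M a (ideal_smult M I L) \<subseteq> N"
    then have I: "ideal I R" and L: "submodule L R M" by auto
    note iff = M.elt_smult_ideal_smult_subset_iff[OF _ L idc[OF I] a]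
    have "I \<subseteq> ring_colon R M N (elt_smult M a L)" using iff[OF N] * by simp
    moreover have "\<not> I \<subseteq> ring_colon R M {\<zero>\<^bsub>M\<^esub>} (elt_smult M a L)"
      using iff[OF Z] * nz[OF nz_elt[OF ideal_smult_nonempty[OF idne[OF I] M.submoduleE(2)[OF L]]]]
      by blast
    \<comment> \<open>If aL is not inside \<open>N\<close>, condition (4) applies. Its first
      alternative would put \<open>I\<close> into (0 :_R aL), so the second one holds.\<close>
    ultimately have "elt_smult M a L \<subseteq> N \<or> I \<subseteq> ring_colon R M N L"
      using \<open>?c4\<close> a L by metis
    then show "elt_smult M a L \<subseteq> N \<or> ideal_smult M I L \<subseteq> N"
      using M.ideal_smult_subset_iff[OF N idc[OF I]] by simp
  qed

  have c56: ?c6 if ?c5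
  proof (intro allI impI)
    fix I L assume *: "ideal I R \<and> submodule L R M \<and> \<not> ideal_smult M I L \<subseteq> N"
    then have I: "ideal I R" and L: "submodule L R M" by auto
    show "ring_colon R M N (ideal_smult M I L) = ring_colon R M {\<zero>\<^bsub>M\<^esub>} (ideal_smult M I L) \<or>
      ring_colon R M N (ideal_smult M I L) = ring_colon R M N L"
    proof (rule M.ring_colon_cases[OF N subc[OF L] M.ideal_smult_subset[OF L idc[OF I]]])
      fix r assume "r \<in> carrier R" "elt_smult M r (ideal_smult M I L) \<subseteq> N"
      \<comment> \<open>Condition (5) is used with r as the ring element; its alternative that IL
        lies in \<open>N\<close> is excluded by assumption.\<close>
      then show "elt_smult M r (ideal_smult M I L) \<subseteq> {\<zero>\<^bsub>M\<^esub>} \<or> elt_smult M r L \<subseteq> N"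
        using \<open>?c5\<close> I L * by blast
    qed
  qed

  have c67: ?c7 if ?c6
  proof (intro allI impI)
    fix I J L assume "ideal I R \<and> ideal J R \<and> submodule L R M"
      and *: "ideal_smult M (ideal_prod R I J) L \<noteq> {\<zero>\<^bsub>M\<^esub>} \<and>
        ideal_smult M (ideal_prod R I J) L \<subseteq> N"
    then have I: "ideal I R" and J: "ideal J R" and L: "submodule L R M" by auto
    note iff = M.ideal_prod_smult_subset_iff[OF _ L I J]
    have "I \<subseteq> ring_colon R M N (ideal_smult M J L)" using iff[OF N] * by simp
    moreover have "\<not> I \<subseteq> ring_colon R M {\<zero>\<^bsub>M\<^esub>} (ideal_smult M J L)"
      using iff[OF Z] *
        nz[OF ideal_smult_nonempty[OF ideal_prod_nonempty[OF idne[OF I] idne[OF J]]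
            M.submoduleE(2)[OF L]]]
      by blast
    \<comment> \<open>The same exclusion with the ideal \<open>J\<close> in place of a: if JL is not
      inside \<open>N\<close>, condition (6) for \<open>J\<close> and \<open>L\<close> leaves only
      (N :_R JL) = (N :_R L).\<close>
    ultimately have "ideal_smult M J L \<subseteq> N \<or> I \<subseteq> ring_colon R M N L"
      using \<open>?c6\<close> J L by metis
    then show "ideal_smult M I L \<subseteq> N \<or> ideal_smult M J L \<subseteq> N"
      using M.ideal_smult_subset_iff[OF N idc[OF I]] by blast
  qed

  have c71: ?c1 if ?c7
    unfolding weakly_classical_prime_def
  proof (intro conjI ballI impI)
    fix a b m assume a: "a \<in> carrier R" and b: "b \<in> carrier R" and m: "m \<in> carrier M"
      and *: "(a \<otimes>\<^bsub>R\<^esub> b) \<odot>\<^bsub>M\<^esub> m \<noteq> \<zero>\<^bsub>M\<^esub> \<and> (a \<otimes>\<^bsub>R\<^esub> b) \<odot>\<^bsub>M\<^esub> m \<in> N"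
    define I J L where "I = PIdl\<^bsub>R\<^esub> a" and "J = PIdl\<^bsub>R\<^esub> b" and "L = (\<lambda>c. c \<odot>\<^bsub>M\<^esub> m) ` carrier R"
    have I: "ideal I R" and J: "ideal J R" and L: "submodule L R M"
      unfolding I_def J_def L_def using M.R.cgenideal_ideal a b M.cyclic_submodule[OF m] by auto
    note iff = M.cgenideal_prod_smult_cyclic_subset_iff[OF _ a b m, folded I_def J_def L_def]
    \<comment> \<open>The criterion is used twice: for \<open>N\<close> it gives the containment,
      and for the zero submodule it turns abm being nonzero into IJL being nonzero.\<close>
    have "ideal_smult M (ideal_prod R I J) L \<subseteq> N" "ideal_smult M (ideal_prod R I J) L \<noteq> {\<zero>\<^bsub>M\<^esub>}"
      using iff[OF N] iff[OF Z] * by auto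
    then have "ideal_smult M I L \<subseteq> N \<or> ideal_smult M J L \<subseteq> N" using \<open>?c7\<close> I J L by blast
    moreover have "ideal_smult M (PIdl\<^bsub>R\<^esub> c) L \<subseteq> N \<longleftrightarrow> c \<odot>\<^bsub>M\<^esub> m \<in> N" if c: "c \<in> carrier R" for c
      unfolding M.cgenideal_smult_subset_iff[OF N L c]
      unfolding L_def M.elt_smult_cyclic_subset_iff[OF N c m] ..
    ultimately show "a \<odot>\<^bsub>M\<^esub> m \<in> N \<or> b \<odot>\<^bsub>M\<^esub> m \<in> N" using a b unfolding I_def J_def by blast
  qed (fact assms(3))

  show ?thesis
    using c12 c23 c34 c45 c56 c67 c71 by argo
qed

end
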